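(* Let $(X,\|\cdot\|)$ be a real Banach space and let $T:X\to X$ be an enriched $\mathcal{A}$-contraction. Then $T$ has a unique fixed point in $X$, and there exists $\lambda\in(0,1]$ such that, for any $u_0\in X$, the sequence $\{u_n\}$ defined by $u_{n+1}=(1-\lambda)u_n+\lambda Tu_n$, $n\ge 0$, converges to that fixed point.
   Context: Write $\mathbb{R}_+=[0,\infty)$. Let $\mathcal{A}$ be the collection of all mappings $f:\mathbb{R}_+^3\to\mathbb{R}$ satisfying: ($\mathcal{A}_1$) $f$ is continuous; ($\mathcal{A}_2$) there exists $k\in[0,1)$ such that for all $r,s\in\mathbb{R}_+$: if $r\le f(s,r,s)$ or $r\le f(r,s,s)$, then $r\le ks$; ($\mathcal{A}_3$) for all $\lambda>0$ and all $r,s,t\in\mathbb{R}_+$, $\lambda f(r,s,t)\le f(\lambda r,\lambda s,\lambda t)$. Let $(X,\|\cdot\|)$ be a real Banach space. A mapping $T:X\to X$ is called an enriched $\mathcal{A}$-contraction if there exist $b\in[0,\infty)$ and $f\in\mathcal{A}$ such that $$\|b(u-v)+Tu-Tv\|\le f\big((b+1)\|u-v\|,\ \|u-Tu\|,\ \|v-Tv\|\big)$$ for all $u,v\in X$ with $u\ne v$. *)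

theory Defs
  imports "HOL-Analysis.Analysis"
begin

text \<open>
  A mapping from triples of nonnegative reals to the reals is represented by a total function
  on triples of reals. Every condition is restricted to nonnegative arguments, so the values
  elsewhere are irrelevant.
\<close>

definition class_A :: "(real \<times> real \<times> real \<Rightarrow> real) set" where
  "class_A = {f.
     continuous_on ({0..} \<times> {0..} \<times> {0..}) f \<and>
     (\<exists>k\<in>{0..<1}. \<forall>r\<ge>0. \<forall>s\<ge>0.
        r \<le> f (s, r, s) \<or> r \<le> f (r, s, s) \<longrightarrow> r \<le> k * s) \<and>
     (\<forall>c>0. \<forall>r\<ge>0. \<forall>s\<ge>0. \<forall>t\<ge>0.
        c * f (r, s, t) \<le> f (c * r, c * s, c * t))}"

definition enriched_A_contraction :: "('a::real_normed_vector \<Rightarrow> 'a) \<Rightarrow> bool" where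
  "enriched_A_contraction T \<longleftrightarrow>
     (\<exists>b\<ge>0. \<exists>f\<in>class_A. \<forall>u v. u \<noteq> v \<longrightarrow>
        norm (b *\<^sub>R (u - v) + T u - T v)
          \<le> f ((b + 1) * norm (u - v), norm (u - T u), norm (v - T v)))"

end

theory Submission
  imports Defs
begin

text \<open>
  Averaging removes the enrichment. Put \<open>l = 1 / (b + 1)\<close> and \<open>S u = (1 - l) u + l T u\<close>. Then
  \<open>b (u - v) + T u - T v = (b + 1) (S u - S v)\<close> and \<open>u - T u = (b + 1) (u - S u)\<close>, so every
  quantity in the enriched condition carries the same factor \<open>b + 1\<close>, and the superhomogeneity
  of \<open>f\<close> at \<open>1 / (b + 1)\<close> cancels it:
  \<open>dist (S u) (S v) \<le> f (dist u v, dist u (S u), dist v (S v))\<close>. Since \<open>l \<noteq> 0\<close>, the maps \<open>S\<close>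
  and \<open>T\<close> have the same fixed points, and the iteration in the theorem is the Picard iteration
  of \<open>S\<close>.

  For such a map \<open>S\<close> on a complete metric space the two alternatives of the implicit condition
  \<open>r \<le> f (s, r, s) \<or> r \<le> f (r, s, s) \<longrightarrow> r \<le> k s\<close> do different work. The first makes consecutive
  distances of a Picard orbit decay geometrically, so that the orbit converges
  (\<open>A_contraction_step\<close>, \<open>convergent_if_geometric_steps\<close>). It also shows, in the
  limit, with \<open>s = 0\<close> and \<open>r\<close> the displacement of the limit point, that this point is fixed
  (\<open>A_contraction_limit_fixed\<close>). The second, with \<open>s = 0\<close> and \<open>r\<close> the distance of two fixed
  points, gives uniqueness (\<open>A_contraction_fixed_unique\<close>).
\<close>

text \<open>
  The enriched condition with \<open>b = 0\<close> and with \<open>f\<close> fixed, in a form that needs no linear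
  structure.
\<close>

definition A_contraction :: "(real \<times> real \<times> real \<Rightarrow> real) \<Rightarrow> ('a::metric_space \<Rightarrow> 'a) \<Rightarrow> bool" where
  "A_contraction f S \<longleftrightarrow>
     (\<forall>u v. u \<noteq> v \<longrightarrow> dist (S u) (S v) \<le> f (dist u v, dist u (S u), dist v (S v)))"

lemma class_A_continuous_on: "f \<in> class_A \<Longrightarrow> continuous_on ({0..} \<times> {0..} \<times> {0..}) f"
  by (simp add: class_A_def)

lemma class_A_factor:
  assumes "f \<in> class_A"
  obtains k where "0 \<le> k" "k < 1"
    "\<forall>r\<ge>0. \<forall>s\<ge>0. r \<le> f (s, r, s) \<or> r \<le> f (r, s, s) \<longrightarrow> r \<le> k * s"
proof -
  from assms obtain k where "k \<in> {0..<1}"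
    and k: "\<forall>r\<ge>0. \<forall>s\<ge>0. r \<le> f (s, r, s) \<or> r \<le> f (r, s, s) \<longrightarrow> r \<le> k * s"
    unfolding class_A_def mem_Collect_eq by (elim conjE bexE)
  then show thesis
    by (intro that[OF _ _ k]) simp_all
qed

text \<open>
  The implicit condition at \<open>s = 0\<close>, where the bound \<open>k s\<close> vanishes: the form in which a limit
  point is recognised as fixed and two fixed points as equal.
\<close>

lemma class_A_degenerate:
  assumes "f \<in> class_A" "0 \<le> r" "r \<le> f (0, r, 0) \<or> r \<le> f (r, 0, 0)"
  shows "r = 0"
proof -
  obtain k where "\<forall>r\<ge>0. \<forall>s\<ge>0. r \<le> f (s, r, s) \<or> r \<le> f (r, s, s) \<longrightarrow> r \<le> k * s"
    using assms(1) by (rule class_A_factor)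
  from this[rule_format, of r 0] assms(2,3) show ?thesis by simp
qed

lemma class_A_superhomogeneous:
  "\<lbrakk>f \<in> class_A; 0 < c; 0 \<le> r; 0 \<le> s; 0 \<le> t\<rbrakk> \<Longrightarrow> c * f (r, s, t) \<le> f (c * r, c * s, c * t)"
  by (simp add: class_A_def)

text \<open>
  By the triangle inequality the distance is at most a finite geometric sum. The form with the
  factor \<open>1 - k\<close> on the left and a difference of powers on the right is the one that
  is stable under adding a step.
\<close>

lemma dist_le_if_geometric_steps:
  fixes x :: "nat \<Rightarrow> 'a::metric_space"
  assumes "k \<le> 1" and step: "\<And>n. dist (x n) (x (Suc n)) \<le> k ^ n * d"
  shows "(1 - k) * dist (x m) (x (m + j)) \<le> (k ^ m - k ^ (m + j)) * d"
proof (induction j)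
  case 0
  show ?case by simp
next
  case (Suc j)
  have "(1 - k) * dist (x m) (x (m + Suc j))
      \<le> (1 - k) * (dist (x m) (x (m + j)) + dist (x (m + j)) (x (Suc (m + j))))"
    using \<open>k \<le> 1\<close> by (intro mult_left_mono) (auto intro: dist_triangle)
  also have "\<dots> \<le> (k ^ m - k ^ (m + j)) * d + (1 - k) * (k ^ (m + j) * d)"
    unfolding distrib_left
    using Suc step[of "m + j"] \<open>k \<le> 1\<close> by (intro add_mono mult_left_mono) auto
  also have "\<dots> = (k ^ m - k ^ (m + Suc j)) * d"
    by (simp add: algebra_simps)
  finally show ?case .
qed

lemma convergent_if_geometric_steps:
  fixes x :: "nat \<Rightarrow> 'a::complete_space"
  assumes k: "0 \<le> k" "k < 1" and step: "\<And>n. dist (x n) (x (Suc n)) \<le> k ^ n * d"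
  shows "convergent x"
proof -
  have "0 \<le> d"
    using order_trans[OF zero_le_dist step[of 0]] by simp
  have bound: "dist (x m) (x n) \<le> k ^ m * (d / (1 - k))" if "m < n" for m n
  proof -
    have "(1 - k) * dist (x m) (x n) \<le> (k ^ m - k ^ n) * d"
      using dist_le_if_geometric_steps[of k x d m "n - m"] k step that by simp
    also have "\<dots> \<le> k ^ m * d"
      using k \<open>0 \<le> d\<close> by (intro mult_right_mono) auto
    finally show ?thesis
      using k by (simp add: field_simps)
  qed
  have tail: "(\<lambda>m. k ^ m * (d / (1 - k))) \<longlonglongrightarrow> 0"
    using k by (intro tendsto_mult_left_zero LIMSEQ_power_zero) simp
  have "Cauchy x"
  proof (rule CauchyI')
    fix e :: real
    assume "0 < e"
    with tail have "\<forall>\<^sub>F m in sequentially. k ^ m * (d / (1 - k)) < e"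
      by (rule order_tendstoD(2))
    then obtain M where "k ^ m * (d / (1 - k)) < e" if "M \<le> m" for m
      unfolding eventually_sequentially by auto
    then have "dist (x m) (x n) < e" if "M \<le> m" "m < n" for m n
      using bound[OF that(2)] that(1) le_less_trans by blast
    then show "\<exists>M. \<forall>m\<ge>M. \<forall>n>m. dist (x m) (x n) < e"
      by auto
  qed
  then show ?thesis
    by (rule Cauchy_convergent)
qed

text \<open>
  Comparing \<open>S u\<close> with \<open>u\<close>, in this order, puts the new displacement into the second slot of
  \<open>f\<close> and the old one into the first and third, which is the first alternative of the implicit
  condition.
\<close>

lemma A_contraction_step:
  assumes S: "A_contraction f S"
    and factor: "\<And>r s. \<lbrakk>0 \<le> r; 0 \<le> s; r \<le> f (s, r, s)\<rbrakk> \<Longrightarrow> r \<le> k * s"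
  shows "dist (S u) (S (S u)) \<le> k * dist u (S u)"
proof (cases "S u = u")
  case True
  then show ?thesis by simp
next
  case False
  with S have "dist (S (S u)) (S u) \<le> f (dist (S u) u, dist (S u) (S (S u)), dist u (S u))"
    by (simp add: A_contraction_def)
  then show ?thesis
    by (intro factor) (simp_all add: dist_commute)
qed

text \<open>
  Let \<open>r\<close> be the displacement of the limit point. If it were positive, the displacements along
  the orbit, which tend to zero, would eventually be smaller; hence the orbit would eventually
  avoid the limit point, and the contraction inequality would be available along the orbit.
  Its limit is \<open>r \<le> f (0, r, 0)\<close>, which forces \<open>r = 0\<close>.
\<close>

lemma A_contraction_limit_fixed:
  assumes f: "f \<in> class_A" and S: "A_contraction f S"
    and orbit: "\<And>n. x (Suc n) = S (x n)" and lim: "x \<longlonglongrightarrow> p"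
  shows "S p = p"
proof (rule ccontr)
  assume "S p \<noteq> p"
  then have pos: "0 < dist p (S p)" by simp
  have limS: "(\<lambda>n. S (x n)) \<longlonglongrightarrow> p"
    using LIMSEQ_Suc[OF lim] by (simp add: orbit)
  have disp: "(\<lambda>n. dist (x n) (S (x n))) \<longlonglongrightarrow> 0"
    using tendsto_dist[OF lim limS] by simp
  have args: "(\<lambda>n. (dist p (x n), dist p (S p), dist (x n) (S (x n)))) \<longlonglongrightarrow> (0, dist p (S p), 0)"
    using tendsto_dist[OF tendsto_const[of p] lim] disp by (intro tendsto_Pair) auto
  have rhs: "(\<lambda>n. f (dist p (x n), dist p (S p), dist (x n) (S (x n)))) \<longlonglongrightarrow> f (0, dist p (S p), 0)"
    by (rule continuous_on_tendsto_compose[OF class_A_continuous_on[OF f] args]) auto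
  have lhs: "(\<lambda>n. dist (S p) (S (x n))) \<longlonglongrightarrow> dist (S p) p"
    by (intro tendsto_intros limS)
  have "\<forall>\<^sub>F n in sequentially. dist (x n) (S (x n)) < dist p (S p)"
    using disp pos by (rule order_tendstoD(2))
  then have "\<forall>\<^sub>F n in sequentially.
      dist (S p) (S (x n)) \<le> f (dist p (x n), dist p (S p), dist (x n) (S (x n)))"
  proof eventually_elim
    case (elim n)
    then have "p \<noteq> x n" by auto
    with S show ?case by (simp add: A_contraction_def)
  qed
  then have "dist p (S p) \<le> f (0, dist p (S p), 0)"
    using tendsto_le[OF sequentially_bot rhs lhs] by (simp add: dist_commute)
  then have "dist p (S p) = 0"
    by (intro class_A_degenerate[OF f]) simp_all
  with pos show False by simp
qed

lemma A_contraction_fixed_unique: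
  assumes f: "f \<in> class_A" and S: "A_contraction f S" and "S p = p" "S q = q"
  shows "q = p"
proof (rule ccontr)
  assume "q \<noteq> p"
  with S have "dist (S q) (S p) \<le> f (dist q p, dist q (S q), dist p (S p))"
    by (simp add: A_contraction_def)
  with \<open>S p = p\<close> \<open>S q = q\<close> have "dist q p \<le> f (dist q p, 0, 0)"
    by simp
  then have "dist q p = 0"
    by (intro class_A_degenerate[OF f]) simp_all
  with \<open>q \<noteq> p\<close> show False by simp
qed

lemma A_contraction_orbit_convergent:
  fixes S :: "'a::complete_space \<Rightarrow> 'a"
  assumes f: "f \<in> class_A" and S: "A_contraction f S" and orbit: "\<And>n. x (Suc n) = S (x n)"
  shows "convergent x"
proof -
  obtain k where k: "0 \<le> k" "k < 1"
    and factor: "\<forall>r\<ge>0. \<forall>s\<ge>0. r \<le> f (s, r, s) \<or> r \<le> f (r, s, s) \<longrightarrow> r \<le> k * s"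
    using f by (rule class_A_factor)
  have "dist (x n) (x (Suc n)) \<le> k ^ n * dist (x 0) (x 1)" for n
  proof (induction n)
    case 0
    show ?case by simp
  next
    case (Suc n)
    have "dist (x (Suc n)) (x (Suc (Suc n))) \<le> k * dist (x n) (x (Suc n))"
      unfolding orbit using S by (rule A_contraction_step) (simp add: factor)
    also have "\<dots> \<le> k * (k ^ n * dist (x 0) (x 1))"
      using Suc k by (intro mult_left_mono)
    finally show ?case by (simp add: mult.assoc)
  qed
  then show ?thesis
    by (rule convergent_if_geometric_steps[OF k])
qed

theorem A_contraction_fixed_point:
  fixes S :: "'a::complete_space \<Rightarrow> 'a"
  assumes f: "f \<in> class_A" and S: "A_contraction f S"
  obtains p where "S p = p" "\<forall>q. S q = q \<longrightarrow> q = p"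
    "\<forall>x. (\<forall>n. x (Suc n) = S (x n)) \<longrightarrow> x \<longlonglongrightarrow> p"
proof -
  have to_fixed: "\<exists>p. S p = p \<and> x \<longlonglongrightarrow> p" if orbit: "\<And>n. x (Suc n) = S (x n)" for x
  proof -
    obtain p where "x \<longlonglongrightarrow> p"
      using A_contraction_orbit_convergent[OF f S, of x] orbit by (auto simp: convergent_def)
    with A_contraction_limit_fixed[OF f S, of x p] orbit show ?thesis by auto
  qed
  \<comment> \<open>Any orbit produces a fixed point, so its starting point is arbitrary.\<close>
  obtain p where p: "S p = p"
    using to_fixed[of "\<lambda>n. (S ^^ n) undefined"] by auto
  have unique: "q = p" if "S q = q" for q
    using A_contraction_fixed_unique[OF f S p that] .
  show thesis
  proof (rule that[of p])
    show "S p = p" by (rule p)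
    show "\<forall>q. S q = q \<longrightarrow> q = p" using unique by simp
    show "\<forall>x. (\<forall>n. x (Suc n) = S (x n)) \<longrightarrow> x \<longlonglongrightarrow> p"
      using to_fixed unique by metis
  qed
qed

definition averaged :: "real \<Rightarrow> ('a::real_vector \<Rightarrow> 'a) \<Rightarrow> 'a \<Rightarrow> 'a" where
  "averaged l T u = (1 - l) *\<^sub>R u + l *\<^sub>R T u"

lemma averaged_fixed_iff:
  assumes "l \<noteq> 0"
  shows "averaged l T u = u \<longleftrightarrow> T u = u"
proof -
  have "averaged l T u - u = l *\<^sub>R (T u - u)"
    by (simp add: averaged_def algebra_simps)
  with assms show ?thesis
    by (metis eq_iff_diff_eq_0 scaleR_eq_0_iff)
qed

text \<open>
  The weight \<open>l = 1 / (b + 1)\<close> is the one with \<open>1 - l = l b\<close>: for it the difference of two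
  averaged values is \<open>l\<close> times the vector whose norm the enriched condition bounds.
\<close>

lemma A_contraction_averaged:
  fixes T :: "'a::real_normed_vector \<Rightarrow> 'a"
  assumes f: "f \<in> class_A" and "0 \<le> b"
    and T: "\<And>u v. u \<noteq> v \<Longrightarrow> norm (b *\<^sub>R (u - v) + T u - T v)
          \<le> f ((b + 1) * norm (u - v), norm (u - T u), norm (v - T v))"
  shows "A_contraction f (averaged (1 / (b + 1)) T)"
  unfolding A_contraction_def
proof (intro allI impI)
  fix u v :: 'a
  assume "u \<noteq> v"
  define l where "l = 1 / (b + 1)"
  have l: "0 < l" "l * (b + 1) = 1" "l * b = 1 - l"
    using \<open>0 \<le> b\<close> by (auto simp: l_def field_simps)
  have disp: "dist w (averaged l T w) = l * norm (w - T w)" for w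
  proof -
    have "w - averaged l T w = l *\<^sub>R (w - T w)"
      by (simp add: averaged_def algebra_simps)
    with l show ?thesis by (simp add: dist_norm)
  qed
  have "averaged l T u - averaged l T v = (l * b) *\<^sub>R (u - v) + l *\<^sub>R (T u - T v)"
    unfolding l(3) by (simp add: averaged_def algebra_simps)
  also have "\<dots> = l *\<^sub>R (b *\<^sub>R (u - v) + T u - T v)"
    by (simp add: algebra_simps)
  finally have "dist (averaged l T u) (averaged l T v) = l * norm (b *\<^sub>R (u - v) + T u - T v)"
    using l by (simp add: dist_norm)
  also have "\<dots> \<le> l * f ((b + 1) * norm (u - v), norm (u - T u), norm (v - T v))"
    using T[OF \<open>u \<noteq> v\<close>] l by (intro mult_left_mono) auto
  also have "\<dots> \<le> f (l * ((b + 1) * norm (u - v)), l * norm (u - T u), l * norm (v - T v))"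
    using \<open>0 \<le> b\<close> l by (intro class_A_superhomogeneous[OF f]) auto
  also have "\<dots> = f (dist u v, dist u (averaged l T u), dist v (averaged l T v))"
    using l(2) by (simp add: disp dist_norm[of u v] flip: mult.assoc)
  finally show "dist (averaged (1 / (b + 1)) T u) (averaged (1 / (b + 1)) T v)
      \<le> f (dist u v, dist u (averaged (1 / (b + 1)) T u), dist v (averaged (1 / (b + 1)) T v))"
    unfolding l_def .
qed

theorem theorem3p1:
  fixes T :: "'a::banach \<Rightarrow> 'a"
  assumes "enriched_A_contraction T"
  shows "\<exists>p. T p = p \<and> (\<forall>q. T q = q \<longrightarrow> q = p) \<and>
           (\<exists>l::real. 0 < l \<and> l \<le> 1 \<and>
              (\<forall>u0. \<forall>u::nat \<Rightarrow> 'a.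
                 u 0 = u0 \<longrightarrow>
                 (\<forall>n. u (Suc n) = (1 - l) *\<^sub>R u n + l *\<^sub>R T (u n)) \<longrightarrow>
                 u \<longlonglongrightarrow> p))"
proof -
  from assms obtain b f where b: "0 \<le> b" and f: "f \<in> class_A"
    and T: "\<And>u v. u \<noteq> v \<Longrightarrow> norm (b *\<^sub>R (u - v) + T u - T v)
          \<le> f ((b + 1) * norm (u - v), norm (u - T u), norm (v - T v))"
    unfolding enriched_A_contraction_def by blast
  define l where "l = 1 / (b + 1)"
  have l: "0 < l" "l \<le> 1"
    using b by (auto simp: l_def)
  have fixed_iff: "averaged l T u = u \<longleftrightarrow> T u = u" for u
    using l by (intro averaged_fixed_iff) simp
  have "A_contraction f (averaged l T)"
    unfolding l_def using f b T by (rule A_contraction_averaged)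
  with f obtain p where p: "averaged l T p = p" "\<forall>q. averaged l T q = q \<longrightarrow> q = p"
    and lim: "\<forall>u. (\<forall>n. u (Suc n) = averaged l T (u n)) \<longrightarrow> u \<longlonglongrightarrow> p"
    by (rule A_contraction_fixed_point)
  show ?thesis
  proof (intro exI[of _ p] exI[of _ l] conjI allI impI)
    show "T p = p"
      using p(1) unfolding fixed_iff .
    show "q = p" if "T q = q" for q
      using p(2) that unfolding fixed_iff by simp
    show "u \<longlonglongrightarrow> p" if "\<forall>n. u (Suc n) = (1 - l) *\<^sub>R u n + l *\<^sub>R T (u n)" for u
      using lim that by (simp add: averaged_def)
  qed (use l in auto)
qed

end
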